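(* For all positive integers $n,q$ there is a function $f_{nq}$ that is simple of order $n$ and such that $h:=f_{nq}\circ x^{1/q}$, i.e. $h(x)=f_{nq}(x^{1/q})$ for $x>0$, is simple of order $n\,q$. Indeed, an example of such a function is $$f_{nq}(x):=\sum_{k=1}^{n}e^{x^{kq+1}}.$$
   Context: Let $K$ be one of $\mathbb{Q},\mathbb{R},\mathbb{C}$. A homogeneous linear ordinary differential equation $\sum_{k=0}^{N}p_k(x)\,y^{(k)}(x)=0$ whose coefficients $p_k$ are polynomials in $x$ over $K$, with $p_N\not\equiv 0$, is called a simple differential equation of order $N$. A function satisfying some simple differential equation is called simple; its order is the least order of a simple differential equation that it satisfies. *)

theory Defs
  imports "HOL-Analysis.Analysis" "HOL-Computational_Algebra.Polynomial"
begin

text \<open>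
  Functions are complex-valued functions of a real variable, considered on an open set
  \<open>S\<close> of reals; values outside \<open>S\<close> are irrelevant. The coefficient field \<open>K\<close> is given as a
  subfield of the complex numbers, so that \<open>\<rat>\<close>, \<open>\<real>\<close> and \<open>UNIV\<close> (of type \<^typ>\<open>complex set\<close>)
  stand for the rational, real and complex numbers.
\<close>

definition nth_deriv :: "nat \<Rightarrow> (real \<Rightarrow> complex) \<Rightarrow> real \<Rightarrow> complex" where
  "nth_deriv k y = ((\<lambda>g x. vector_derivative g (at x)) ^^ k) y"

text \<open>
  Since \<^const>\<open>vector_derivative\<close> is total, existence of the derivatives is a separate condition.
\<close>

definition times_differentiable_on :: "nat \<Rightarrow> (real \<Rightarrow> complex) \<Rightarrow> real set \<Rightarrow> bool" where
  "times_differentiable_on N y S \<longleftrightarrow> (\<forall>k<N. \<forall>x\<in>S. nth_deriv k y differentiable (at x))"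

definition simple_ode :: "complex set \<Rightarrow> nat \<Rightarrow> (nat \<Rightarrow> complex poly) \<Rightarrow> bool" where
  "simple_ode K N p \<longleftrightarrow> (\<forall>k\<le>N. \<forall>i. coeff (p k) i \<in> K) \<and> p N \<noteq> 0"

definition solves_ode_on ::
    "nat \<Rightarrow> (nat \<Rightarrow> complex poly) \<Rightarrow> (real \<Rightarrow> complex) \<Rightarrow> real set \<Rightarrow> bool" where
  "solves_ode_on N p y S \<longleftrightarrow> times_differentiable_on N y S \<and>
     (\<forall>x\<in>S. (\<Sum>k=0..N. poly (p k) (complex_of_real x) * nth_deriv k y x) = 0)"

definition satisfies_simple_ode ::
    "complex set \<Rightarrow> real set \<Rightarrow> (real \<Rightarrow> complex) \<Rightarrow> nat \<Rightarrow> bool" where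
  "satisfies_simple_ode K S y N \<longleftrightarrow> (\<exists>p. simple_ode K N p \<and> solves_ode_on N p y S)"

definition simple_on :: "complex set \<Rightarrow> real set \<Rightarrow> (real \<Rightarrow> complex) \<Rightarrow> bool" where
  "simple_on K S y \<longleftrightarrow> (\<exists>N. satisfies_simple_ode K S y N)"

definition simple_order :: "complex set \<Rightarrow> real set \<Rightarrow> (real \<Rightarrow> complex) \<Rightarrow> nat" where
  "simple_order K S y = (LEAST N. satisfies_simple_ode K S y N)"

definition simple_of_order :: "complex set \<Rightarrow> real set \<Rightarrow> (real \<Rightarrow> complex) \<Rightarrow> nat \<Rightarrow> bool" where
  "simple_of_order K S y N \<longleftrightarrow> simple_on K S y \<and> simple_order K S y = N"

definition f_nq :: "nat \<Rightarrow> nat \<Rightarrow> real \<Rightarrow> complex" where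
  "f_nq n q x = (\<Sum>k=1..n. exp (complex_of_real x ^ (k * q + 1)))"

end

theory Submission
  imports Defs
begin

text \<open>
  Put \<open>x = t ^ Q\<close> and consider \<open>y = (\<Sum>k=1..n. exp (t ^ m k))\<close> as a function of \<open>x\<close>, where the
  exponents \<open>m 1 < \<dots> < m n\<close> are at least \<open>2\<close> and coprime to \<open>Q\<close>. Then \<open>y\<close> is simple of order exactly
  \<open>n * Q\<close> (\<open>exp_sum_simple_of_order\<close>). With \<open>m k = k * q + 1\<close>, the case \<open>Q = 1\<close> is the statement
  on \<open>f_nq n q\<close> and the case \<open>Q = q\<close> is the statement on its composition with the \<open>q\<close>-th root.

  The \<open>j\<close>-th derivative of \<open>exp (t ^ m)\<close> with respect to \<open>x\<close> is \<open>exp (t ^ m)\<close> times a Laurent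
  polynomial in \<open>t\<close> with rational coefficients and degree \<open>j * (m - Q)\<close>. Exponentials of different powers
  of \<open>t\<close> are linearly independent over the polynomials in \<open>t\<close> (\<open>exp_powers_independent\<close>), so a
  differential operator \<open>\<Sum>j\<le>N. p j * D ^ j\<close> kills \<open>y\<close> if and only if for each \<open>k\<close> the Laurent
  polynomials that belong to \<open>exp (t ^ m k)\<close> cancel.

  Upper bound: these are \<open>n\<close> relations between Laurent polynomials in \<open>t\<close>, hence \<open>n * Q\<close>
  relations between polynomials in \<open>x = t ^ Q\<close>, one for each residue class of exponents modulo \<open>Q\<close>.
  They have a nonzero solution as soon as there are \<open>n * Q + 1\<close> unknown polynomials \<open>p j\<close>
  (\<open>rational_polynomial_relation\<close>). The solution can be taken rational, so it serves for every
  coefficient field.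

  Lower bound: for each \<open>k\<close> the highest degree \<open>Q * degree (p j) + j * (m k - Q)\<close> must occur
  for two indices \<open>j\<close>. These span an edge of the Newton polygon of the points
  \<open>(j, Q * degree (p j))\<close>. Since \<open>m k\<close> is coprime to \<open>Q\<close>, its horizontal length is a multiple of
  \<open>Q\<close>. Different \<open>k\<close> give different slopes, so the polygon has \<open>n\<close> edges of length at least \<open>Q\<close> and the
  order is at least \<open>n * Q\<close> (\<open>newton_polygon_width\<close>, \<open>exp_sum_ode_order_ge\<close>).
\<close>

section \<open>Rational polynomial relations by counting coefficients\<close>

text \<open>
  Gaussian elimination over \<open>\<rat>\<close> inside a field of characteristic zero, one equation at a time:
  solving an equation for an unknown \<open>i0\<close> and substituting leaves the remaining system with
  one equation and one unknown less.
\<close>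
lemma rational_kernel_vector:
  fixes a :: "'j \<Rightarrow> 'i \<Rightarrow> 'a::field_char_0"
  assumes "finite J" "finite I" "card J < card I"
    and "\<And>j i. j \<in> J \<Longrightarrow> i \<in> I \<Longrightarrow> a j i \<in> \<rat>"
  shows "\<exists>c. (\<forall>i. c i \<in> \<rat>) \<and> (\<exists>i\<in>I. c i \<noteq> 0) \<and> (\<forall>j\<in>J. (\<Sum>i\<in>I. a j i * c i) = 0)"
  using assms
proof (induction J arbitrary: I a rule: finite_induct)
  case empty
  then have "I \<noteq> {}" by auto
  then show ?case by (intro exI[of _ "\<lambda>_. 1"]) auto
next
  case (insert j J)
  show ?case
  proof (cases "\<forall>i\<in>I. a j i = 0")
    case True
    obtain c where "\<forall>i. c i \<in> \<rat>" "\<exists>i\<in>I. c i \<noteq> 0" "\<forall>j\<in>J. (\<Sum>i\<in>I. a j i * c i) = 0"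
      using insert.IH[of I a] insert.prems insert.hyps by auto
    then show ?thesis using True by (intro exI[of _ c]) auto
  next
    case False
    then obtain i0 where i0: "i0 \<in> I" "a j i0 \<noteq> 0" by blast
    define I' where "I' = I - {i0}"
    define a' where "a' = (\<lambda>l i. a l i - a l i0 * a j i / a j i0)"
    have "\<exists>c. (\<forall>i. c i \<in> \<rat>) \<and> (\<exists>i\<in>I'. c i \<noteq> 0) \<and> (\<forall>l\<in>J. (\<Sum>i\<in>I'. a' l i * c i) = 0)"
    proof (rule insert.IH)
      show "finite I'" using insert.prems by (simp add: I'_def)
      show "card J < card I'" using insert.prems insert.hyps i0 by (simp add: I'_def)
      show "a' l i \<in> \<rat>" if "l \<in> J" "i \<in> I'" for l i
        using insert.prems(3) that i0 unfolding a'_def I'_def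
        by (intro Rats_diff Rats_divide Rats_mult) auto
    qed
    then obtain c where c: "\<And>i. c i \<in> \<rat>" "\<exists>i\<in>I'. c i \<noteq> 0"
        "\<And>l. l \<in> J \<Longrightarrow> (\<Sum>i\<in>I'. a' l i * c i) = 0" by blast
    define s where "s = (\<Sum>i\<in>I'. a j i * c i)"
    define c' where "c' = c(i0 := - s / a j i0)"
    have s: "s \<in> \<rat>" unfolding s_def
      using insert.prems(3) c(1) by (intro Rats_sum Rats_mult) (auto simp: I'_def)
    have split: "(\<Sum>i\<in>I. a l i * c' i) = (\<Sum>i\<in>I'. a l i * c i) - a l i0 * s / a j i0" for l
    proof -
      have "(\<Sum>i\<in>I. a l i * c' i) = a l i0 * c' i0 + (\<Sum>i\<in>I'. a l i * c' i)"
        unfolding I'_def using insert.prems i0 by (intro sum.remove) auto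
      also have "(\<Sum>i\<in>I'. a l i * c' i) = (\<Sum>i\<in>I'. a l i * c i)"
        by (intro sum.cong) (auto simp: c'_def I'_def)
      finally show ?thesis by (simp add: c'_def)
    qed
    have "(\<Sum>i\<in>I. a l i * c' i) = 0" if "l \<in> J" for l
    proof -
      have "(\<Sum>i\<in>I'. a' l i * c i) = (\<Sum>i\<in>I'. a l i * c i) - a l i0 * s / a j i0"
        unfolding a'_def s_def sum_distrib_left sum_divide_distrib sum_subtractf[symmetric]
        by (intro sum.cong) (auto simp: field_simps)
      then show ?thesis using c(3)[OF that] split by simp
    qed
    moreover have "(\<Sum>i\<in>I. a j i * c' i) = 0" using split[of j] i0 by (simp add: s_def)
    moreover have "\<forall>i. c' i \<in> \<rat>"
      using c(1) s i0 insert.prems(3)[of j i0] by (auto simp: c'_def intro!: Rats_divide)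
    moreover have "\<exists>i\<in>I. c' i \<noteq> 0" using c(2) by (auto simp: c'_def I'_def)
    ultimately show ?thesis by (intro exI[of _ c']) auto
  qed
qed

text \<open>
  Why equations of order \<open>n * Q\<close> exist. If the unknown \<open>p 0, \<dots>, p (n * Q)\<close> have degree at most
  \<open>D\<close>, they have \<open>(n * Q + 1) * (D + 1)\<close> coefficients altogether, whereas the \<open>n\<close>
  relations are polynomial identities of degree at most \<open>Q * D + C\<close> and so impose
  \<open>n * (Q * D + C + 1)\<close> linear conditions. The difference contains \<open>D\<close> with coefficient \<open>1\<close>,
  so a large \<open>D\<close> leaves more unknowns than conditions.
\<close>
lemma rational_polynomial_relation:
  fixes B :: "nat \<Rightarrow> nat \<Rightarrow> complex poly"
  assumes Q: "Q > 0" and B: "\<And>k j i. coeff (B k j) i \<in> \<rat>"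
  obtains p :: "nat \<Rightarrow> complex poly" where
    "\<And>j i. coeff (p j) i \<in> \<rat>" and "\<exists>j\<le>n * Q. p j \<noteq> 0"
    and "\<And>k. k \<in> {1..n} \<Longrightarrow> (\<Sum>j\<le>n * Q. pcompose (p j) (monom 1 Q) * B k j) = 0"
proof -
  define N where "N = n * Q"
  define C where "C = Max ((\<lambda>(k,j). degree (B k j)) ` ({1..n} \<times> {..N}))"
  have C: "degree (B k j) \<le> C" if "k \<in> {1..n}" "j \<le> N" for k j
    unfolding C_def using that by (intro Max_ge) auto
  \<comment> \<open>the part of the number of conditions that does not grow with \<open>D\<close>\<close>
  define D where "D = n * (C + 1)"
  define I where "I = {..N} \<times> {..D}"
  define J where "J = {1..n} \<times> {..Q * D + C}"
  define a where "a = (\<lambda>(k,e) (j,d). coeff (monom 1 (Q * d) * B k j) e)"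
  have "\<exists>c. (\<forall>i. c i \<in> \<rat>) \<and> (\<exists>i\<in>I. c i \<noteq> 0) \<and> (\<forall>l\<in>J. (\<Sum>i\<in>I. a l i * c i) = 0)"
  proof (rule rational_kernel_vector)
    have "card J = N * D + D" by (simp add: J_def N_def D_def algebra_simps)
    moreover have "card I = N * D + D + N + 1" by (simp add: I_def algebra_simps)
    ultimately show "card J < card I" by simp
  qed (auto simp: I_def J_def a_def coeff_monom_mult B split: prod.splits)
  then obtain c where c: "\<And>i. c i \<in> \<rat>" "\<exists>i\<in>I. c i \<noteq> 0"
      "\<And>l. l \<in> J \<Longrightarrow> (\<Sum>i\<in>I. a l i * c i) = 0" by blast
  define p where "p = (\<lambda>j. \<Sum>d\<le>D. monom (c (j,d)) d)"
  have coeff_p: "coeff (p j) i = (if i \<le> D then c (j,i) else 0)" for j i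
    by (simp add: p_def coeff_sum if_distrib cong: if_cong)
  have pc: "pcompose (p j) (monom 1 Q) = (\<Sum>d\<le>D. smult (c (j,d)) (monom 1 (Q * d)))" for j
    unfolding p_def pcompose_sum
  proof (rule sum.cong)
    fix d
    show "pcompose (monom (c (j,d)) d) (monom 1 Q) = smult (c (j,d)) (monom 1 (Q * d))"
      by (rule poly_eq_poly_eq_iff[THEN iffD1])
        (auto simp: poly_pcompose poly_monom power_mult fun_eq_iff)
  qed simp
  show thesis
  proof
    show "coeff (p j) i \<in> \<rat>" for j i using c(1) by (simp add: coeff_p)
    obtain j d where "j \<le> N" "d \<le> D" "c (j,d) \<noteq> 0" using c(2) by (auto simp: I_def)
    then have "coeff (p j) d \<noteq> 0" by (simp add: coeff_p)
    then show "\<exists>j\<le>n * Q. p j \<noteq> 0" using \<open>j \<le> N\<close> by (intro exI[of _ j]) (auto simp: N_def)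
  next
    fix k assume k: "k \<in> {1..n}"
    let ?T = "\<Sum>j\<le>N. pcompose (p j) (monom 1 Q) * B k j"
    have T: "?T = (\<Sum>(j,d)\<in>I. smult (c (j,d)) (monom 1 (Q * d) * B k j))"
      unfolding pc I_def sum.cartesian_product[symmetric]
      by (simp add: sum_distrib_right)
    have "coeff ?T e = 0" for e
    proof (cases "e \<le> Q * D + C")
      case True
      have "coeff ?T e = (\<Sum>i\<in>I. a (k,e) i * c i)"
        unfolding T coeff_sum by (intro sum.cong) (auto simp: a_def)
      then show ?thesis using c(3)[of "(k,e)"] k True by (auto simp: J_def)
    next
      case False
      have "coeff (monom 1 (Q * d) * B k j) e = 0" if "(j,d) \<in> I" for j d
      proof -
        have "Q * d \<le> Q * D" using that by (auto simp: I_def)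
        moreover have "degree (B k j) \<le> C" using that k by (intro C) (auto simp: I_def)
        ultimately have "coeff (B k j) (e - Q * d) = 0" using False by (intro coeff_eq_0) linarith
        then show ?thesis by (simp add: coeff_monom_mult)
      qed
      then show ?thesis unfolding T coeff_sum by (intro sum.neutral) auto
    qed
    then show "(\<Sum>j\<le>n * Q. pcompose (p j) (monom 1 Q) * B k j) = 0"
      unfolding N_def[symmetric] by (intro poly_eqI) simp
  qed
qed

section \<open>Independence of exponentials of powers over the polynomials\<close>

text \<open>
  For \<open>t \<ge> 1\<close> already \<open>t ^ a - t ^ b \<le> 1 - t\<close>, so each exponential is dominated by \<open>exp (1 - t)\<close>.
\<close>
lemma poly_times_exp_power_diff_tendsto_0:
  fixes P :: "complex poly"
  assumes "a < b"
  shows "((\<lambda>t::real. poly P (of_real t) * exp (of_real t ^ a - of_real t ^ b)) \<longlongrightarrow> 0) at_top"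
proof -
  have "((\<lambda>t::real. norm (coeff P i) * exp 1 * (t ^ i / exp t)) \<longlongrightarrow> 0) at_top" for i
    using tendsto_mult_left[OF tendsto_power_div_exp_0[of i], of "norm (coeff P i) * exp 1"] by simp
  then have lim: "((\<lambda>t::real. \<Sum>i\<le>degree P. norm (coeff P i) * exp 1 * (t ^ i / exp t)) \<longlongrightarrow> 0) at_top"
    using tendsto_sum[of "{..degree P}" "\<lambda>i t. norm (coeff P i) * exp 1 * (t ^ i / exp t)" "\<lambda>_. 0"]
    by simp
  have bound: "norm (poly P (of_real t) * exp (of_real t ^ a - of_real t ^ b))
      \<le> (\<Sum>i\<le>degree P. norm (coeff P i) * exp 1 * (t ^ i / exp t))" if t: "t \<ge> 1" for t :: real
  proof -
    have "t ^ a * (t - 1) \<le> t ^ a * (t ^ (b - a) - 1)"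
      using t assms by (intro mult_left_mono diff_right_mono self_le_power) auto
    moreover have "1 * (t - 1) \<le> t ^ a * (t - 1)"
      using t by (intro mult_right_mono one_le_power) auto
    ultimately have le: "t ^ a - t ^ b \<le> 1 - t"
      using assms by (simp add: right_diff_distrib flip: power_add)
    have "exp (of_real t ^ a - of_real t ^ b) = complex_of_real (exp (t ^ a - t ^ b))"
      by (metis exp_of_real of_real_diff of_real_power)
    then have "norm (exp (of_real t ^ a - of_real t ^ b :: complex)) \<le> exp (1 - t)"
      using le by (simp del: of_real_exp)
    moreover have "norm (poly P (of_real t)) \<le> (\<Sum>i\<le>degree P. norm (coeff P i) * t ^ i)"
      unfolding poly_altdef using t
      by (intro order_trans[OF norm_sum] sum_mono) (simp add: norm_mult norm_power)
    ultimately have "norm (poly P (of_real t) * exp (of_real t ^ a - of_real t ^ b))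
        \<le> (\<Sum>i\<le>degree P. norm (coeff P i) * t ^ i) * exp (1 - t)"
      unfolding norm_mult using t by (intro mult_mono sum_nonneg) auto
    also have "\<dots> = (\<Sum>i\<le>degree P. norm (coeff P i) * exp 1 * (t ^ i / exp t))"
      unfolding sum_distrib_right by (intro sum.cong) (simp_all add: exp_diff)
    finally show ?thesis .
  qed
  show ?thesis
    by (rule Lim_null_comparison[OF _ lim])
      (use bound in \<open>auto intro!: eventually_mono[OF eventually_ge_at_top[of 1]]\<close>)
qed

lemma poly_eq_0_if_tendsto_0:
  fixes P :: "complex poly"
  assumes lim: "((\<lambda>t::real. poly P (of_real t)) \<longlongrightarrow> 0) at_top"
  shows "P = 0"
proof (cases "degree P = 0")
  case True
  then obtain c where c: "P = [:c:]" by (metis degree_eq_zeroE)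
  then have "((\<lambda>t::real. c) \<longlongrightarrow> 0) at_top" using lim by simp
  then have "c = 0" by (simp add: tendsto_const_iff)
  then show ?thesis by (simp add: c)
next
  case False
  have "filterlim (of_real :: real \<Rightarrow> complex) at_infinity at_top"
    by (intro filterlim_of_real_at_infinity)
  then have "filterlim (\<lambda>t::real. poly P (of_real t)) at_infinity at_top"
    using filterlim_poly_at_infinity[of P] False by (auto intro: filterlim_compose)
  then show ?thesis
    using not_tendsto_and_filterlim_at_infinity[OF _ lim] by simp
qed

text \<open>
  Among the exponentials with a nonzero coefficient, dividing by the fastest growing one shows
  that its coefficient tends to \<open>0\<close> along the positive axis; a polynomial that does so vanishes.
\<close>
lemma exp_powers_independent:
  fixes P :: "'k \<Rightarrow> complex poly" and m :: "'k \<Rightarrow> nat"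
  assumes "finite I" "inj_on m I"
    and zero: "\<And>t::real. t > 0 \<Longrightarrow> (\<Sum>k\<in>I. poly (P k) (of_real t) * exp (of_real t ^ m k)) = 0"
    and "k \<in> I"
  shows "P k = 0"
proof (rule ccontr)
  assume "P k \<noteq> 0"
  define J where "J = {k\<in>I. P k \<noteq> 0}"
  have J: "finite J" "J \<noteq> {}" using assms \<open>P k \<noteq> 0\<close> by (auto simp: J_def)
  obtain k0 where k0: "k0 \<in> J" "\<And>l. l \<in> J \<Longrightarrow> m l \<le> m k0"
    using obtains_MAX[OF J, of m] Max_ge[of "m ` J"] J(1) by (metis finite_imageI imageI)
  have less: "m l < m k0" if "l \<in> J - {k0}" for l
  proof -
    have "m l \<noteq> m k0" using that k0(1) assms(2) by (auto simp: J_def inj_on_def)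
    then show ?thesis using k0(2)[of l] that by auto
  qed
  have eq: "poly (P k0) (of_real t) =
      - (\<Sum>l\<in>J - {k0}. poly (P l) (of_real t) * exp (of_real t ^ m l - of_real t ^ m k0))"
    if "t > 0" for t :: real
  proof -
    have "0 = (\<Sum>l\<in>J. poly (P l) (of_real t) * exp (of_real t ^ m l))"
      unfolding zero[OF that, symmetric] J_def using assms(1)
      by (intro sum.mono_neutral_right) auto
    also have "\<dots> = exp (of_real t ^ m k0) *
        (\<Sum>l\<in>J. poly (P l) (of_real t) * exp (of_real t ^ m l - of_real t ^ m k0))"
      by (simp add: sum_distrib_left exp_diff)
    finally have "(\<Sum>l\<in>J. poly (P l) (of_real t) * exp (of_real t ^ m l - of_real t ^ m k0)) = 0"
      by simp
    then show ?thesis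
      using sum.remove[OF J(1) k0(1), of "\<lambda>l. poly (P l) (of_real t) * exp (of_real t ^ m l - of_real t ^ m k0)"]
      by (simp add: eq_neg_iff_add_eq_0)
  qed
  have "((\<lambda>t::real. - (\<Sum>l\<in>J - {k0}. poly (P l) (of_real t) *
      exp (of_real t ^ m l - of_real t ^ m k0))) \<longlongrightarrow> - (\<Sum>l\<in>J - {k0}. 0)) at_top"
    by (intro tendsto_minus tendsto_sum poly_times_exp_power_diff_tendsto_0 less)
  then have "((\<lambda>t::real. poly (P k0) (of_real t)) \<longlongrightarrow> 0) at_top"
    by (subst tendsto_cong[OF eventually_mono[OF eventually_gt_at_top[of 0] eq]]) auto
  then have "P k0 = 0" by (rule poly_eq_0_if_tendsto_0)
  then show False using k0(1) by (simp add: J_def)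
qed

section \<open>Newton polygons\<close>

text \<open>
  A leading term of highest degree can be cancelled only by another term of the same degree.
\<close>
lemma max_degree_attained_twice:
  fixes T :: "nat \<Rightarrow> 'a::comm_ring_1 poly"
  assumes "finite J" "J \<noteq> {}" "\<And>j. j \<in> J \<Longrightarrow> T j \<noteq> 0" "(\<Sum>j\<in>J. T j) = 0"
  obtains i j where "i \<in> J" "j \<in> J" "i < j" "degree (T i) = degree (T j)"
    and "\<And>l. l \<in> J \<Longrightarrow> degree (T l) \<le> degree (T i)"
proof -
  obtain i where i: "i \<in> J" "\<And>l. l \<in> J \<Longrightarrow> degree (T l) \<le> degree (T i)"
    using obtains_MAX[OF assms(1,2), of "\<lambda>j. degree (T j)"] Max_ge[of "(\<lambda>j. degree (T j)) ` J"] assms(1)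
    by (metis finite_imageI imageI)
  have "\<exists>j\<in>J. j \<noteq> i \<and> degree (T j) = degree (T i)"
  proof (rule ccontr)
    assume *: "\<not> ?thesis"
    have "coeff (T j) (degree (T i)) = 0" if "j \<in> J - {i}" for j
      using * that i(2)[of j] by (intro coeff_eq_0) force
    then have "(\<Sum>j\<in>J. coeff (T j) (degree (T i))) = lead_coeff (T i)"
      using sum.remove[OF assms(1) i(1), of "\<lambda>j. coeff (T j) (degree (T i))"] by simp
    moreover have "(\<Sum>j\<in>J. coeff (T j) (degree (T i))) = 0"
      using assms(4) by (simp flip: coeff_sum)
    ultimately show False using assms(3)[OF i(1)] by simp
  qed
  then obtain j where j: "j \<in> J" "j \<noteq> i" "degree (T j) = degree (T i)" by blast
  show thesis
    using that[of i j] that[of j i] i j by (cases "i < j") auto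
qed

text \<open>
  The numbers \<open>d l + int l * s k\<close> are the values at the points \<open>(l, d l)\<close> of a linear form; their
  maximizers span the edge of slope \<open>- s k\<close> of the upper convex hull of these points. The hull is
  concave, so edges belonging to increasing \<open>s k\<close> lie one to the right of the other. Hence \<open>n\<close> edges
  of horizontal length at least \<open>Q\<close> force a point with abscissa at least \<open>n * Q\<close>. For the induction,
  this point is chosen as the right end of the last edge.
\<close>
lemma newton_polygon_width:
  fixes d :: "nat \<Rightarrow> int" and s :: "nat \<Rightarrow> int"
  assumes s: "strict_mono s" and n: "n > 0"
    and edge: "\<And>k. k \<in> {1..n} \<Longrightarrow> \<exists>i\<in>J. \<exists>j\<in>J. i + Q \<le> j \<and>
        d i + int i * s k = d j + int j * s k \<and> (\<forall>l\<in>J. d l + int l * s k \<le> d i + int i * s k)"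
  shows "\<exists>j\<in>J. n * Q \<le> j \<and> (\<forall>l\<in>J. d l + int l * s n \<le> d j + int j * s n)"
  using n edge
proof (induction n)
  case (Suc n)
  obtain i j where ij: "i \<in> J" "j \<in> J" "i + Q \<le> j"
      "d i + int i * s (Suc n) = d j + int j * s (Suc n)"
      "\<And>l. l \<in> J \<Longrightarrow> d l + int l * s (Suc n) \<le> d i + int i * s (Suc n)"
    using Suc.prems(2)[of "Suc n"] by auto
  \<comment> \<open>the new edge starts at or beyond the right end of the previous one\<close>
  have "n * Q \<le> i"
  proof (cases "n = 0")
    case False
    then obtain j0 where j0: "j0 \<in> J" "n * Q \<le> j0"
        "\<And>l. l \<in> J \<Longrightarrow> d l + int l * s n \<le> d j0 + int j0 * s n"
      using Suc.IH Suc.prems(2) by auto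
    have "0 \<le> (int i - int j0) * (s (Suc n) - s n)"
      using ij(5)[OF j0(1)] j0(3)[OF ij(1)] by (simp add: algebra_simps)
    moreover have "s n < s (Suc n)" using s by (simp add: strict_mono_def)
    ultimately have "j0 \<le> i" by (simp add: zero_le_mult_iff)
    then show ?thesis using j0(2) by simp
  qed simp
  then show ?case using ij by (intro bexI[of _ j]) auto
qed simp

section \<open>Derivatives of exponentials of powers of a root\<close>

text \<open>
  With \<open>x = t ^ Q\<close> one has \<open>d/dx = t / (Q * t ^ Q) * d/dt\<close>, so \<open>j\<close> derivatives of \<open>exp (t ^ m)\<close>
  with respect to \<open>x\<close> produce \<open>A t * exp (t ^ m) / t ^ (e * j)\<close> for the polynomial
  \<open>A = deriv_factor Q e r m j\<close> and \<open>e = Q\<close>, \<open>r = 1\<close>. For \<open>Q = 1\<close> the denominators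
  are spurious and hide the regularity at \<open>t = 0\<close>; there the choice \<open>e = r = 0\<close>
  expresses the derivatives without them. The parameters cover both conventions:
  \<open>d/dx = t ^ r / (Q * t ^ e) * d/dt\<close>.
\<close>
primrec deriv_factor :: "nat \<Rightarrow> nat \<Rightarrow> nat \<Rightarrow> nat \<Rightarrow> nat \<Rightarrow> complex poly" where
  "deriv_factor Q e r m 0 = 1"
| "deriv_factor Q e r m (Suc j) = smult (1 / of_nat Q)
     (monom 1 r * pderiv (deriv_factor Q e r m j) +
      monom (of_nat m) (m + r - 1) * deriv_factor Q e r m j -
      smult (of_nat (e * j)) (deriv_factor Q e r m j))"

lemma deriv_factor_rational: "coeff (deriv_factor Q e r m j) i \<in> \<rat>"
proof (induction j arbitrary: i)
  case 0
  then show ?case by (simp add: coeff_1)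
next
  case (Suc j)
  then show ?case
    by (auto simp: coeff_monom_mult coeff_pderiv simp del: of_nat_mult of_nat_Suc
        intro!: Rats_mult Rats_diff Rats_add Rats_divide)
qed

text \<open>
  In the recursion, the term coming from the derivative of \<open>exp (t ^ m)\<close> raises the degree by
  \<open>m + r - 1\<close>, strictly more than the other two terms do.
\<close>
lemma deriv_factor_degree:
  assumes "m \<ge> 2" "Q > 0"
  shows "deriv_factor Q e r m j \<noteq> 0" "degree (deriv_factor Q e r m j) = j * (m + r - 1)"
proof -
  let ?A = "deriv_factor Q e r m"
  define d where "d = m + r - 1"
  have *: "(\<forall>i>j * d. coeff (?A j) i = 0) \<and> coeff (?A j) (j * d) \<noteq> 0"
  proof (induction j)
    case (Suc j)
    have top: "coeff (?A (Suc j)) i =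
        1 / of_nat Q * (of_nat m * coeff (?A j) (i - d))" if "i \<ge> Suc j * d" for i
    proof -
      have "d \<le> i" "j * d \<le> i - d" "i \<noteq> 0" "r \<le> i" "j * d < Suc (i - r)" "j * d < i"
        using that assms by (auto simp: d_def)
      then show ?thesis
        using Suc.IH by (simp add: coeff_monom_mult coeff_pderiv d_def)
    qed
    have "coeff (?A (Suc j)) i = 0" if "i > Suc j * d" for i
      using Suc.IH that top[of i] by simp
    moreover have "coeff (?A (Suc j)) (Suc j * d) \<noteq> 0"
      using Suc.IH assms top[of "Suc j * d"] by simp
    ultimately show ?case by blast
  qed simp
  then show "?A j \<noteq> 0" by auto
  show "degree (?A j) = j * (m + r - 1)"
    using * unfolding d_def by (intro antisym degree_le le_degree) auto
qed

text \<open>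
  A function \<open>\<tau>\<close> of \<open>x\<close> with \<open>\<tau> x ^ Q = x\<close>, in the two conventions described for
  \<^const>\<open>deriv_factor\<close>: the identity on the whole line, and the positive root on the positive
  half-line. The values of \<open>\<tau>\<close> include all positive numbers, so that identities between functions
  of \<open>x\<close> turn into identities for large \<open>t\<close>.
\<close>
locale root_chart =
  fixes S :: "real set" and \<tau> :: "real \<Rightarrow> real" and Q e r :: nat
  assumes open_S: "open S"
    and Q_pos: "Q > 0"
    and weights: "e + 1 = Q + r" "e = 0 \<or> r = 1"
    and power_chart: "x \<in> S \<Longrightarrow> \<tau> x ^ Q = x"
    and deriv_chart:
      "x \<in> S \<Longrightarrow> (\<tau> has_real_derivative \<tau> x ^ r / (real Q * \<tau> x ^ e)) (at x)"
    and chart_nonzero: "x \<in> S \<Longrightarrow> \<tau> x ^ e \<noteq> 0"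
    and chart_covers: "t > 0 \<Longrightarrow> \<exists>x\<in>S. \<tau> x = t"
begin

abbreviation A :: "nat \<Rightarrow> nat \<Rightarrow> complex poly" where "A \<equiv> deriv_factor Q e r"

abbreviation tc :: "real \<Rightarrow> complex" where "tc x \<equiv> complex_of_real (\<tau> x)"

lemma deriv_factor_step:
  assumes "x \<in> S" "m \<ge> 1"
  shows "((\<lambda>x. poly (A m j) (tc x) * exp (tc x ^ m) / tc x ^ (e * j)) has_vector_derivative
           poly (A m (Suc j)) (tc x) * exp (tc x ^ m) / tc x ^ (e * Suc j)) (at x)"
proof -
  define z where "z = tc x"
  have ze: "z ^ e \<noteq> 0" using chart_nonzero[OF assms(1)] by (simp add: z_def)
  let ?F = "\<lambda>z. poly (A m j) z * exp (z ^ m) / z ^ (e * j)"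
  let ?F' = "(poly (pderiv (A m j)) z * exp (z ^ m) +
      poly (A m j) z * (of_nat m * z ^ (m - 1) * exp (z ^ m)) -
      ?F z * (of_nat (e * j) * z ^ (e * j - 1))) / z ^ (e * j)"
  have F: "((\<lambda>z. poly (A m j) z * exp (z ^ m) / z ^ N) has_field_derivative
      (poly (pderiv (A m j)) z * exp (z ^ m) +
      poly (A m j) z * (of_nat m * z ^ (m - 1) * exp (z ^ m)) -
      poly (A m j) z * exp (z ^ m) / z ^ N * (of_nat N * z ^ (N - 1))) / z ^ N) (at z)"
    if "z ^ N \<noteq> 0" for N
    using that by (auto intro!: derivative_eq_intros simp: field_simps)
  have "z ^ (e * j) \<noteq> 0" using ze by (simp add: power_mult)
  then have "(?F has_field_derivative ?F') (at z)" by (rule F)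
  moreover have "(tc has_vector_derivative of_real (\<tau> x ^ r / (real Q * \<tau> x ^ e))) (at x)"
    using deriv_chart[OF assms(1)]
    by (intro has_vector_derivative_of_real) (simp add: has_real_derivative_iff_has_vector_derivative)
  ultimately have "((?F \<circ> tc) has_vector_derivative
      of_real (\<tau> x ^ r / (real Q * \<tau> x ^ e)) * ?F') (at x)"
    unfolding z_def by (intro field_vector_diff_chain_at)
  moreover have "of_real (\<tau> x ^ r / (real Q * \<tau> x ^ e)) * ?F' =
      poly (A m (Suc j)) z * exp (z ^ m) / z ^ (e * Suc j)"
  proof -
    have mr: "z ^ (m + r - 1) = z ^ r * z ^ (m - 1)"
      using assms(2) by (simp add: add.commute flip: power_add)
    \<comment> \<open>either \<open>e = 0\<close>, and both sides vanish, or \<open>r = 1\<close>\<close>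
    have ej: "z ^ r * (of_nat (e * j) * z ^ (e * j - 1)) = of_nat (e * j) * z ^ (e * j)"
    proof (cases "e * j = 0")
      case False
      then show ?thesis using weights(2) by (auto simp: power_eq_if)
    qed (simp only: of_nat_0 mult_zero_left mult_zero_right)
    have "of_real (\<tau> x ^ r / (real Q * \<tau> x ^ e)) * ?F' = (z ^ r * ?F') / (of_nat Q * z ^ e)"
      by (simp add: z_def)
    also have "z ^ r * ?F' = (z ^ r * poly (pderiv (A m j)) z * exp (z ^ m) +
        poly (A m j) z * (of_nat m * (z ^ r * z ^ (m - 1)) * exp (z ^ m)) -
        ?F z * (z ^ r * (of_nat (e * j) * z ^ (e * j - 1)))) / z ^ (e * j)"
      by (simp add: algebra_simps)
    also have "\<dots> = of_nat Q * poly (A m (Suc j)) z * exp (z ^ m) / z ^ (e * j)"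
      unfolding ej mr[symmetric] using ze Q_pos
      by (simp add: poly_monom algebra_simps)
    also have "\<dots> / (of_nat Q * z ^ e) = poly (A m (Suc j)) z * exp (z ^ m) / z ^ (e * Suc j)"
      using Q_pos by (simp add: power_add del: deriv_factor.simps)
    finally show ?thesis .
  qed
  ultimately show ?thesis by (simp add: o_def z_def)
qed

lemma nth_deriv_exp_sum:
  fixes m :: "nat \<Rightarrow> nat" and n :: nat
  defines "y \<equiv> \<lambda>x. \<Sum>k=1..n. exp (tc x ^ m k)"
  assumes m: "\<And>k. k \<in> {1..n} \<Longrightarrow> m k \<ge> 1" and x: "x \<in> S"
  shows "nth_deriv j y x = (\<Sum>k=1..n. poly (A (m k) j) (tc x) * exp (tc x ^ m k)) / tc x ^ (e * j)"
    and "nth_deriv j y differentiable (at x)"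
proof -
  define g where "g = (\<lambda>j x. (\<Sum>k=1..n. poly (A (m k) j) (tc x) * exp (tc x ^ m k) / tc x ^ (e * j)))"
  have g: "(g j has_vector_derivative g (Suc j) x) (at x)" if "x \<in> S" for j x
    unfolding g_def using that m by (intro has_vector_derivative_sum deriv_factor_step) auto
  have D: "(nth_deriv j y has_vector_derivative g (Suc j) x) (at x)"
    if "\<And>x. x \<in> S \<Longrightarrow> nth_deriv j y x = g j x" "x \<in> S" for j x
    using that by (intro has_vector_derivative_transform_within_open[OF g open_S]) auto
  have eq: "nth_deriv j y x = g j x" if "x \<in> S" for x j
    using that
  proof (induction j arbitrary: x)
    case 0
    then show ?case by (simp add: nth_deriv_def g_def y_def)
  next
    case (Suc j)
    have "nth_deriv (Suc j) y x = vector_derivative (nth_deriv j y) (at x)"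
      by (simp add: nth_deriv_def)
    then show ?case using vector_derivative_at[OF D[OF Suc.IH Suc.prems]] by simp
  qed
  show "nth_deriv j y x = (\<Sum>k=1..n. poly (A (m k) j) (tc x) * exp (tc x ^ m k)) / tc x ^ (e * j)"
    using eq[OF x] by (simp add: g_def sum_divide_distrib)
  show "nth_deriv j y differentiable (at x)"
    using D[OF eq x] by (rule differentiableI_vector)
qed

text \<open>
  A differential operator with polynomial coefficients acts on each exponential by multiplication
  with a Laurent polynomial in \<open>t\<close>. The factor \<open>t ^ (e * N)\<close> clears all denominators of an operator
  of order \<open>N\<close>, so the independence of the exponentials applies.
\<close>
lemma operator_exp_sum:
  fixes m :: "nat \<Rightarrow> nat" and p :: "nat \<Rightarrow> complex poly"
  assumes m: "\<And>k. k \<in> {1..n} \<Longrightarrow> m k \<ge> 1" and x: "x \<in> S"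
  shows "tc x ^ (e * N) *
      (\<Sum>j=0..N. poly (p j) (of_real x) * nth_deriv j (\<lambda>x. \<Sum>k=1..n. exp (tc x ^ m k)) x) =
    (\<Sum>k=1..n. poly (\<Sum>j\<le>N. pcompose (p j) (monom 1 Q) * (monom 1 (e * (N - j)) * A (m k) j)) (tc x)
       * exp (tc x ^ m k))"
proof -
  have xQ: "complex_of_real x = tc x ^ Q" using power_chart[OF x] by (metis of_real_power)
  have "tc x ^ (e * N) * (poly (p j) (of_real x) * nth_deriv j (\<lambda>x. \<Sum>k=1..n. exp (tc x ^ m k)) x) =
      (\<Sum>k=1..n. poly (pcompose (p j) (monom 1 Q) * (monom 1 (e * (N - j)) * A (m k) j)) (tc x)
        * exp (tc x ^ m k))" if "j \<le> N" for j
  proof -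
    have "e * N = e * (N - j) + e * j" using that by (simp flip: add_mult_distrib2)
    then have "tc x ^ (e * N) = tc x ^ (e * (N - j)) * tc x ^ (e * j)" by (simp only: power_add)
    moreover have "nth_deriv j (\<lambda>x. \<Sum>k=1..n. exp (tc x ^ m k)) x =
        (\<Sum>k=1..n. poly (A (m k) j) (tc x) * exp (tc x ^ m k)) / tc x ^ (e * j)"
      by (rule nth_deriv_exp_sum(1)) (use m x in auto)
    moreover have "a * b * (c * (s / b)) = c * a * s" if "b \<noteq> 0" for a b c s :: complex
      using that by simp
    note cancel = this[of "tc x ^ (e * j)"]
    moreover have "tc x ^ (e * j) \<noteq> 0" using chart_nonzero[OF x] by (auto simp: power_mult)
    ultimately have "tc x ^ (e * N) *
        (poly (p j) (of_real x) * nth_deriv j (\<lambda>x. \<Sum>k=1..n. exp (tc x ^ m k)) x) =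
        poly (p j) (tc x ^ Q) * tc x ^ (e * (N - j)) *
        (\<Sum>k=1..n. poly (A (m k) j) (tc x) * exp (tc x ^ m k))"
      unfolding xQ by (simp only: not_False_eq_True)
    then show ?thesis by (simp add: poly_pcompose poly_monom sum_distrib_left mult.assoc)
  qed
  then have "tc x ^ (e * N) *
      (\<Sum>j\<le>N. poly (p j) (of_real x) * nth_deriv j (\<lambda>x. \<Sum>k=1..n. exp (tc x ^ m k)) x) =
      (\<Sum>j\<le>N. \<Sum>k=1..n. poly (pcompose (p j) (monom 1 Q) * (monom 1 (e * (N - j)) * A (m k) j)) (tc x)
        * exp (tc x ^ m k))"
    unfolding sum_distrib_left by (intro sum.cong) auto
  also have "\<dots> = (\<Sum>k=1..n. poly (\<Sum>j\<le>N. pcompose (p j) (monom 1 Q) * (monom 1 (e * (N - j)) * A (m k) j)) (tc x)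
       * exp (tc x ^ m k))"
    by (subst sum.swap) (simp only: poly_sum sum_distrib_right)
  finally show ?thesis by (simp only: atMost_atLeast0)
qed

section \<open>The order of a sum of exponentials\<close>

text \<open>
  By independence, an operator annihilating the sum annihilates each \<open>exp (t ^ m k)\<close>. Its terms are
  polynomials in \<open>t\<close> of degree \<open>Q * degree (p j) + j * (m k - Q)\<close>, up to the common shift
  \<open>e * N\<close>. For each \<open>k\<close> the largest degree occurs for two indices \<open>i < j\<close>, and equality of the degrees
  means that \<open>Q\<close> divides \<open>m k * (j - i)\<close>, hence \<open>j - i\<close>, so \<open>i\<close> and \<open>j\<close> are at least \<open>Q\<close>
  apart. So the Newton polygon of the equation has \<open>n\<close> edges of length at least \<open>Q\<close>.
\<close>
lemma exp_sum_ode_order_ge: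
  fixes m :: "nat \<Rightarrow> nat"
  assumes m: "strict_mono m" "\<And>k. k \<in> {1..n} \<Longrightarrow> m k \<ge> 2"
    and coprime: "\<And>k. k \<in> {1..n} \<Longrightarrow> coprime (m k) Q" and n: "n > 0"
    and ode: "satisfies_simple_ode K S (\<lambda>x. \<Sum>k=1..n. exp (tc x ^ m k)) N"
  shows "n * Q \<le> N"
proof -
  have m2: "m k \<ge> 1" if "k \<in> {1..n}" for k using m(2)[OF that] by simp
  obtain p where p: "p N \<noteq> 0" "\<And>x. x \<in> S \<Longrightarrow>
      (\<Sum>j=0..N. poly (p j) (of_real x) * nth_deriv j (\<lambda>x. \<Sum>k=1..n. exp (tc x ^ m k)) x) = 0"
    using ode by (auto simp: satisfies_simple_ode_def simple_ode_def solves_ode_on_def)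
  define T where "T = (\<lambda>k j. pcompose (p j) (monom 1 Q) * (monom 1 (e * (N - j)) * A (m k) j))"
  have T0: "(\<Sum>j\<le>N. T k j) = 0" if "k \<in> {1..n}" for k
  proof (rule exp_powers_independent[where P = "\<lambda>k. \<Sum>j\<le>N. T k j" and I = "{1..n}" and m = m])
    show "inj_on m {1..n}" using m(1) by (simp add: strict_mono_imp_inj_on inj_on_subset)
    fix t :: real assume "t > 0"
    then obtain x where x: "x \<in> S" "\<tau> x = t" using chart_covers by blast
    show "(\<Sum>k=1..n. poly (\<Sum>j\<le>N. T k j) (of_real t) * exp (of_real t ^ m k)) = 0"
      using operator_exp_sum[of n m x N p] m2 x p(2)[OF x(1)] by (simp add: T_def)
  qed (use that in auto)
  define J where "J = {j. j \<le> N \<and> p j \<noteq> 0}"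
  have degT: "T k j \<noteq> 0" "int (degree (T k j)) =
      (int (Q * degree (p j)) + int j * (int (m k) - int Q)) + int (e * N)"
    if k: "k \<in> {1..n}" and j: "j \<in> J" for k j
  proof -
    have "pcompose (p j) (monom 1 Q) \<noteq> 0"
      using j Q_pos by (auto simp: J_def degree_monom_eq dest!: pcompose_eq_0)
    moreover note A = deriv_factor_degree[OF m(2)[OF k] Q_pos, of e r j]
    ultimately show "T k j \<noteq> 0" by (simp add: T_def)
    have "degree (T k j) = degree (p j) * Q + (e * (N - j) + j * (m k + r - 1))"
      using \<open>pcompose (p j) (monom 1 Q) \<noteq> 0\<close> A
      by (simp add: T_def degree_mult_eq degree_monom_eq degree_pcompose)
    then have "int (degree (T k j)) =
        int (degree (p j)) * int Q + (int e * int (N - j) + int j * int (m k + r - 1))"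
      by (simp only: of_nat_add of_nat_mult)
    moreover have "int (m k + r - 1) = int (m k) - int Q + int e"
      using weights(1) m2[OF k] by linarith
    moreover have "int (N - j) = int N - int j" using j by (simp add: J_def)
    ultimately show "int (degree (T k j)) =
      (int (Q * degree (p j)) + int j * (int (m k) - int Q)) + int (e * N)"
      by (simp only: of_nat_mult) (simp add: algebra_simps)
  qed
  have "\<exists>j\<in>J. n * Q \<le> j \<and> (\<forall>l\<in>J. int (Q * degree (p l)) + int l * (int (m n) - int Q)
      \<le> int (Q * degree (p j)) + int j * (int (m n) - int Q))"
  proof (rule newton_polygon_width[where s = "\<lambda>k. int (m k) - int Q"])
    show "strict_mono (\<lambda>k. int (m k) - int Q)" using m(1) by (simp add: strict_mono_def)
    fix k assume k: "k \<in> {1..n}"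
    have "(\<Sum>j\<in>J. T k j) = (\<Sum>j\<le>N. T k j)"
      by (intro sum.mono_neutral_left) (auto simp: J_def T_def)
    then have "(\<Sum>j\<in>J. T k j) = 0" using T0[OF k] by simp
    moreover have "finite J" "J \<noteq> {}" using p(1) by (auto simp: J_def)
    ultimately obtain i j where ij: "i \<in> J" "j \<in> J" "i < j" "degree (T k i) = degree (T k j)"
        "\<And>l. l \<in> J \<Longrightarrow> degree (T k l) \<le> degree (T k i)"
      using max_degree_attained_twice[of J "T k"] degT(1)[OF k] by blast
    let ?h = "\<lambda>l. int (Q * degree (p l)) + int l * (int (m k) - int Q)"
    have eq: "?h i = ?h j" using degT(2)[OF k] ij by (metis add_right_cancel)
    have max: "?h l \<le> ?h i" if "l \<in> J" for l
      using degT(2)[OF k ij(1)] degT(2)[OF k that] ij(5)[OF that] by linarith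
    have "int (m k) * (int j - int i) =
        int Q * (int (degree (p i)) - int (degree (p j)) + (int j - int i))"
      using eq by (simp add: algebra_simps)
    then have "int Q dvd int (m k) * (int j - int i)" by simp
    then have "int Q dvd int j - int i"
      using coprime[OF k] by (simp add: coprime_dvd_mult_right_iff coprime_commute)
    then have "Q dvd j - i" using ij(3) by (simp flip: int_dvd_int_iff add: of_nat_diff)
    then have "Q \<le> j - i" using ij(3) by (intro dvd_imp_le) auto
    then show "\<exists>i\<in>J. \<exists>j\<in>J. i + Q \<le> j \<and> ?h i = ?h j \<and> (\<forall>l\<in>J. ?h l \<le> ?h i)"
      using ij eq max by (intro bexI[of _ i] bexI[of _ j]) auto
  qed (rule n)
  then show ?thesis by (auto simp: J_def)
qed

text \<open>
  The relations found by counting coefficients annihilate each exponential separately.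
  Their last coefficient may vanish, so the order obtained here is only at most \<open>n * Q\<close>.
\<close>
lemma exp_sum_satisfies_ode:
  fixes m :: "nat \<Rightarrow> nat"
  assumes K: "\<rat> \<subseteq> K" and m: "\<And>k. k \<in> {1..n} \<Longrightarrow> m k \<ge> 1"
  shows "\<exists>N\<le>n * Q. satisfies_simple_ode K S (\<lambda>x. \<Sum>k=1..n. exp (tc x ^ m k)) N"
proof -
  define B where "B = (\<lambda>k j. monom 1 (e * (n * Q - j)) * A (m k) j)"
  have "coeff (B k j) i \<in> \<rat>" for k j i
    by (simp add: B_def coeff_monom_mult deriv_factor_rational)
  then obtain p where p: "\<And>j i. coeff (p j) i \<in> \<rat>" "\<exists>j\<le>n * Q. p j \<noteq> 0"
    "\<And>k. k \<in> {1..n} \<Longrightarrow> (\<Sum>j\<le>n * Q. pcompose (p j) (monom 1 Q) * B k j) = 0"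
    using rational_polynomial_relation[OF Q_pos, of B n] by blast
  define N where "N = Max {j. j \<le> n * Q \<and> p j \<noteq> 0}"
  have N: "N \<le> n * Q" "p N \<noteq> 0" "\<And>j. j \<le> n * Q \<Longrightarrow> p j \<noteq> 0 \<Longrightarrow> j \<le> N"
    using Max_in[of "{j. j \<le> n * Q \<and> p j \<noteq> 0}"] p(2) unfolding N_def by (auto intro: Max_ge)
  let ?y = "\<lambda>x. \<Sum>k=1..n. exp (tc x ^ m k)"
  have "(\<Sum>j=0..N. poly (p j) (of_real x) * nth_deriv j ?y x) = 0" if x: "x \<in> S" for x
  proof -
    have "(\<Sum>j=0..N. poly (p j) (of_real x) * nth_deriv j ?y x) =
        (\<Sum>j=0..n * Q. poly (p j) (of_real x) * nth_deriv j ?y x)"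
      using N by (intro sum.mono_neutral_left) force+
    moreover have "tc x ^ (e * (n * Q)) *
        (\<Sum>j=0..n * Q. poly (p j) (of_real x) * nth_deriv j ?y x) = 0"
    proof (subst operator_exp_sum)
      show "(\<Sum>k=1..n. poly (\<Sum>j\<le>n * Q. pcompose (p j) (monom 1 Q) *
          (monom 1 (e * (n * Q - j)) * A (m k) j)) (tc x) * exp (tc x ^ m k)) = 0"
        using p(3) by (intro sum.neutral ballI) (simp only: B_def poly_0 mult_zero_left)
    qed (use m x in auto)
    \<comment> \<open>the factor \<open>t ^ (e * (n * Q))\<close> is nonzero: \<open>t\<close> can vanish only if \<open>e = 0\<close>\<close>
    ultimately show ?thesis using chart_nonzero[OF x] by (auto simp: power_mult)
  qed
  then have "satisfies_simple_ode K S ?y N"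
    using N(2) p(1) K nth_deriv_exp_sum(2)[of n m] m
    unfolding satisfies_simple_ode_def simple_ode_def solves_ode_on_def times_differentiable_on_def
    by (intro exI[of _ p]) blast
  then show ?thesis using N(1) by blast
qed

text \<open>
  The lower bound also shows that the relation found by counting has order exactly \<open>n * Q\<close>.
\<close>
theorem exp_sum_simple_of_order:
  fixes m :: "nat \<Rightarrow> nat"
  assumes "\<rat> \<subseteq> K" "strict_mono m" "\<And>k. k \<in> {1..n} \<Longrightarrow> m k \<ge> 2"
    and "\<And>k. k \<in> {1..n} \<Longrightarrow> coprime (m k) Q" "n > 0"
  shows "simple_of_order K S (\<lambda>x. \<Sum>k=1..n. exp (tc x ^ m k)) (n * Q)"
proof -
  let ?P = "satisfies_simple_ode K S (\<lambda>x. \<Sum>k=1..n. exp (tc x ^ m k))"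
  have ge: "n * Q \<le> N" if "?P N" for N
    by (rule exp_sum_ode_order_ge[OF assms(2-5) that])
  have "m k \<ge> 1" if "k \<in> {1..n}" for k using assms(3)[OF that] by simp
  then obtain N where N: "N \<le> n * Q" "?P N"
    using exp_sum_satisfies_ode[of K n m, OF assms(1)] by blast
  then have "?P (n * Q)" using ge[OF N(2)] by simp
  then show ?thesis
    unfolding simple_of_order_def simple_on_def simple_order_def
    by (auto intro!: Least_equality ge)
qed

end

section \<open>The identity and the positive root\<close>
lemma root_chart_id: "root_chart UNIV (\<lambda>x. x) 1 0 0"
  by unfold_locales auto

lemma root_chart_root:
  assumes "q > 0"
  shows "root_chart {0<..} (\<lambda>x. x powr (1 / real q)) q q 1"
proof
  fix x :: real assume x: "x \<in> {0<..}"
  show pow: "(x powr (1 / real q)) ^ q = x"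
    using x assms by (simp add: powr_powr flip: powr_realpow)
  have "((\<lambda>x. x powr (1 / real q)) has_real_derivative (1 / real q) * x powr (1 / real q - 1)) (at x)"
    using x by (intro has_real_derivative_powr) auto
  then show "((\<lambda>x. x powr (1 / real q)) has_real_derivative
      (x powr (1 / real q)) ^ 1 / (real q * (x powr (1 / real q)) ^ q)) (at x)"
    unfolding pow using x by (simp add: powr_diff)
  show "(x powr (1 / real q)) ^ q \<noteq> 0" using pow x by simp
next
  fix t :: real assume t: "t > 0"
  then have "(t ^ q) powr (1 / real q) = t"
    using assms by (simp add: powr_powr flip: powr_realpow)
  then show "\<exists>x\<in>{0<..}. x powr (1 / real q) = t" using t by (intro bexI[of _ "t ^ q"]) auto
qed (use assms in auto)

theorem theorem5:
  fixes K :: "complex set" and n q :: nat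
  assumes K: "K = \<rat> \<or> K = \<real> \<or> K = UNIV"
    and n: "n > 0" and q: "q > 0"
  shows "(\<exists>f :: real \<Rightarrow> complex. simple_of_order K UNIV f n \<and>
            simple_of_order K {0<..} (f \<circ> (\<lambda>x. x powr (1 / real q))) (n * q)) \<and>
         (simple_of_order K UNIV (f_nq n q) n \<and>
            simple_of_order K {0<..} (f_nq n q \<circ> (\<lambda>x. x powr (1 / real q))) (n * q))"
proof -
  have QK: "\<rat> \<subseteq> K" using K by (auto elim!: Rats_cases')
  \<comment> \<open>every exponent is \<open>1\<close> modulo \<open>q\<close>, which makes it coprime to \<open>q\<close>\<close>
  define m where "m = (\<lambda>k. k * q + 1)"
  have m: "strict_mono m" "\<And>k. k \<in> {1..n} \<Longrightarrow> m k \<ge> 2"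
    using q by (auto simp: m_def strict_mono_def Suc_le_eq)
  have coprime: "coprime (m k) q" for k
  proof (rule coprimeI)
    fix c assume "c dvd m k" "c dvd q"
    then show "is_unit c" using dvd_add_right_iff[of c "k * q" 1] by (simp add: m_def)
  qed
  have f: "f_nq n q = (\<lambda>x. \<Sum>k=1..n. exp (of_real x ^ m k))"
    by (simp add: f_nq_def m_def fun_eq_iff)
  have "simple_of_order K UNIV (f_nq n q) n"
    using root_chart.exp_sum_simple_of_order[OF root_chart_id QK m(1,2) _ n] by (simp add: f)
  moreover have "simple_of_order K {0<..} (f_nq n q \<circ> (\<lambda>x. x powr (1 / real q))) (n * q)"
    using root_chart.exp_sum_simple_of_order[OF root_chart_root[OF q] QK m coprime n] by (simp add: f o_def)
  ultimately show ?thesis by blast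
qed

end
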